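(* There exists a set of at least $4$ mutually quasi-unbiased weighing matrices for parameters $(32,32,4,256)$.
   Context: A weighing matrix of order $n$ and weight $k$ is an $n\times n$ matrix $W$ with entries in $\{1,-1,0\}$ such that $WW^T=kI_n$, where $I_n$ is the identity matrix of order $n$ and $W^T$ is the transpose of $W$. Two weighing matrices $W_1,W_2$ of order $n$ and weight $k$ are quasi-unbiased for parameters $(n,k,l,a)$ if $(1/\sqrt{a})\,W_1W_2^T$ is a weighing matrix (of order $n$) of weight $l$. Weighing matrices $W_1,\ldots,W_f$ of order $n$ and weight $k$ are mutually quasi-unbiased weighing matrices for parameters $(n,k,l,a)$ if any distinct two of them are quasi-unbiased for parameters $(n,k,l,a)$. *)

theory Defs
  imports Complex_Main "Jordan_Normal_Form.Matrix"
begin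

definition weighing_matrix :: "nat \<Rightarrow> nat \<Rightarrow> real mat \<Rightarrow> bool" where
  "weighing_matrix n k W \<longleftrightarrow>
     W \<in> carrier_mat n n \<and>
     (\<forall>i<n. \<forall>j<n. W $$ (i, j) \<in> {1, -1, 0}) \<and>
     W * W\<^sup>T = real k \<cdot>\<^sub>m 1\<^sub>m n"

text \<open>
  The condition \<open>a > 0\<close> is implicit in the factor \<open>1 / sqrt a\<close>; it is stated because
  division by zero is total in HOL.
\<close>

definition quasi_unbiased ::
    "nat \<Rightarrow> nat \<Rightarrow> nat \<Rightarrow> nat \<Rightarrow> real mat \<Rightarrow> real mat \<Rightarrow> bool" where
  "quasi_unbiased n k l a W\<^sub>1 W\<^sub>2 \<longleftrightarrow>
     a > 0 \<and> weighing_matrix n k W\<^sub>1 \<and> weighing_matrix n k W\<^sub>2 \<and>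
     weighing_matrix n l ((1 / sqrt (real a)) \<cdot>\<^sub>m (W\<^sub>1 * W\<^sub>2\<^sup>T))"

definition mutually_quasi_unbiased ::
    "nat \<Rightarrow> nat \<Rightarrow> nat \<Rightarrow> nat \<Rightarrow> real mat set \<Rightarrow> bool" where
  "mutually_quasi_unbiased n k l a S \<longleftrightarrow>
     finite S \<and> (\<forall>W\<in>S. weighing_matrix n k W) \<and>
     (\<forall>W\<^sub>1\<in>S. \<forall>W\<^sub>2\<in>S. W\<^sub>1 \<noteq> W\<^sub>2 \<longrightarrow> quasi_unbiased n k l a W\<^sub>1 W\<^sub>2)"

end

theory Submission
  imports Defs "Jordan_Normal_Form.Determinant"
begin

text \<open>
  Identify \<open>{0..<2 ^ (n + 1)}\<close> with \<open>GF(2) ^ (n + 1)\<close> through binary digits \<open>x\<^sub>0, \<dots>, x\<^sub>n\<close>, let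
  \<open>H\<close> be the Sylvester matrix \<open>(-1) ^ (i \<cdot> j)\<close>, and for \<open>A \<subseteq> {0..<n}\<close> scale its columns by the
  signs \<open>(-1) ^ Q\<^sub>A\<close>, where \<open>Q\<^sub>A(x) = x\<^sub>n * (\<Sum>b\<in>A. x\<^sub>b)\<close>. The entries of \<open>W\<^sub>A W\<^sub>B\<^sup>T\<close> are Walsh
  coefficients of \<open>Q\<^sub>A + Q\<^sub>B\<close>, a quadratic form of rank 2 for \<open>A \<noteq> B\<close>, so they lie in
  \<open>{0, 2 ^ n, - 2 ^ n}\<close>. Hence the \<open>2 ^ n\<close> matrices are mutually quasi-unbiased for the parameters
  \<open>(2 ^ (n + 1), 2 ^ (n + 1), 4, 2 ^ (2 n))\<close>; the case \<open>n = 4\<close> gives 16 matrices of order 32.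
\<close>

text \<open>Dividing by \<open>k\<close> makes the transpose a right inverse of \<open>W\<close>,
  and a right inverse of a square matrix is also a left inverse.\<close>

lemma weighing_matrix_transpose_mult:
  assumes "weighing_matrix n k W" "k > 0"
  shows "W\<^sup>T * W = real k \<cdot>\<^sub>m 1\<^sub>m n"
proof -
  have W: "W \<in> carrier_mat n n" and eq: "W * W\<^sup>T = real k \<cdot>\<^sub>m 1\<^sub>m n"
    using assms(1) by (auto simp: weighing_matrix_def)
  have "W * ((1 / real k) \<cdot>\<^sub>m W\<^sup>T) = 1\<^sub>m n"
    using W eq \<open>k > 0\<close> by (subst mult_smult_distrib[of _ n n _ n]) auto
  then have "((1 / real k) \<cdot>\<^sub>m W\<^sup>T) * W = 1\<^sub>m n"
    using W by (intro mat_mult_left_right_inverse[of W n]) auto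
  then have "(1 / real k) \<cdot>\<^sub>m (W\<^sup>T * W) = 1\<^sub>m n"
    using W by (simp add: mult_smult_assoc_mat[of _ n n _ n])
  then have "real k \<cdot>\<^sub>m ((1 / real k) \<cdot>\<^sub>m (W\<^sup>T * W)) = real k \<cdot>\<^sub>m 1\<^sub>m n"
    by simp
  moreover have "real k \<cdot>\<^sub>m ((1 / real k) \<cdot>\<^sub>m (W\<^sup>T * W)) = W\<^sup>T * W"
    using \<open>k > 0\<close> by (intro eq_matI) auto
  ultimately show ?thesis
    by simp
qed

text \<open>Orthogonality of the product is automatic: regrouping around
  \<open>W\<^sup>T * W\<close> gives weight \<open>k\<^sup>2\<close> before scaling, hence
  \<open>l\<close> after division by \<open>c\<close>. Only the entries remain to be checked. Taking
  the last parameter as a square turns its root into \<open>c\<close>.\<close>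

lemma quasi_unbiasedI:
  assumes V: "weighing_matrix n k V" and W: "weighing_matrix n k W"
    and "k > 0" "c > 0" and l: "l * c\<^sup>2 = k\<^sup>2"
    and entries: "\<And>i j. i < n \<Longrightarrow> j < n \<Longrightarrow> (V * W\<^sup>T) $$ (i, j) \<in> {real c, - real c, 0}"
  shows "quasi_unbiased n k l (c\<^sup>2) V W"
proof -
  let ?M = "(1 / real c) \<cdot>\<^sub>m (V * W\<^sup>T)"
  have cV: "V \<in> carrier_mat n n" and cW: "W \<in> carrier_mat n n"
    and VV: "V * V\<^sup>T = real k \<cdot>\<^sub>m 1\<^sub>m n"
    using V W by (auto simp: weighing_matrix_def)
  have WW: "W\<^sup>T * W = real k \<cdot>\<^sub>m 1\<^sub>m n"
    using weighing_matrix_transpose_mult[OF W \<open>k > 0\<close>] .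
  have "(V * W\<^sup>T) * (V * W\<^sup>T)\<^sup>T = (V * W\<^sup>T) * (W * V\<^sup>T)"
    using cV cW by (simp add: transpose_mult[of _ n n _ n])
  also have "\<dots> = V * ((W\<^sup>T * W) * V\<^sup>T)"
    using cV cW by (simp add: assoc_mult_mat[of _ n n _ n _ n])
  also have "\<dots> = real k \<cdot>\<^sub>m (V * V\<^sup>T)"
    using cV by (simp add: WW mult_smult_assoc_mat[of _ n n _ n] mult_smult_distrib[of _ n n _ n])
  also have "\<dots> = (real k)\<^sup>2 \<cdot>\<^sub>m 1\<^sub>m n"
    by (simp add: VV power2_eq_square) (intro eq_matI; simp)
  finally have prod: "(V * W\<^sup>T) * (V * W\<^sup>T)\<^sup>T = (real k)\<^sup>2 \<cdot>\<^sub>m 1\<^sub>m n" .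
  have cM: "V * W\<^sup>T \<in> carrier_mat n n"
    using cV cW by auto
  have "?M\<^sup>T = (1 / real c) \<cdot>\<^sub>m (V * W\<^sup>T)\<^sup>T"
    by (intro eq_matI) auto
  then have "?M * ?M\<^sup>T = (1 / real c) \<cdot>\<^sub>m ((1 / real c) \<cdot>\<^sub>m ((V * W\<^sup>T) * (V * W\<^sup>T)\<^sup>T))"
    using cM by (simp add: mult_smult_assoc_mat[of _ n n _ n] mult_smult_distrib[of _ n n _ n])
  also have "\<dots> = ((real k)\<^sup>2 / (real c)\<^sup>2) \<cdot>\<^sub>m 1\<^sub>m n"
    unfolding prod by (intro eq_matI) (auto simp: power2_eq_square)
  also have "(real k)\<^sup>2 / (real c)\<^sup>2 = real l"
    using \<open>c > 0\<close> by (simp add: field_simps flip: of_nat_power of_nat_mult l)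
  finally have MM: "?M * ?M\<^sup>T = real l \<cdot>\<^sub>m 1\<^sub>m n" .
  have "?M $$ (i, j) \<in> {1, -1, 0}" if "i < n" "j < n" for i j
  proof -
    have "?M $$ (i, j) = (V * W\<^sup>T) $$ (i, j) / real c"
      using that cV cW by (subst index_smult_mat) auto
    then show ?thesis
      using entries[OF that] \<open>c > 0\<close> by (auto simp del: index_mult_mat)
  qed
  with MM cM have "weighing_matrix n l ?M"
    unfolding weighing_matrix_def by (metis smult_carrier_mat)
  then show ?thesis
    using V W \<open>c > 0\<close> by (simp add: quasi_unbiased_def)
qed

lemma bit_add_pow2:
  fixes j :: nat
  assumes "j < 2 ^ n"
  shows "b < n \<Longrightarrow> bit (j + 2 ^ n) b = bit j b" "bit (j + 2 ^ n) n" "\<not> bit j n"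
proof -
  assume "b < n"
  then have pow: "(2::nat) ^ n = 2 ^ (n - b) * 2 ^ b"
    by (simp flip: power_add)
  \<comment> \<open>The added term \<open>2 ^ (n - b)\<close> is even because \<open>b < n\<close>,
    so the parity that defines bit \<open>b\<close> does not change.\<close>
  have "(j + 2 ^ n) div 2 ^ b = j div 2 ^ b + 2 ^ (n - b)"
    unfolding pow by simp
  then show "bit (j + 2 ^ n) b = bit j b"
    using \<open>b < n\<close> by (simp add: bit_iff_odd)
qed (use assms in \<open>auto simp: bit_iff_odd\<close>)

lemma sum_lessThan_pow2_Suc:
  fixes f :: "nat \<Rightarrow> 'a::comm_monoid_add"
  shows "(\<Sum>j<2 ^ Suc n. f j) = (\<Sum>j<2 ^ n. f j) + (\<Sum>j<2 ^ n. f (j + 2 ^ n))"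
proof -
  have "(\<Sum>j<2 ^ Suc n. f j) = sum f {0..<2 ^ n} + sum f {2 ^ n..<2 ^ n + 2 ^ n}"
    by (simp add: sum.atLeastLessThan_concat mult_2 flip: atLeast0LessThan)
  also have "sum f {2 ^ n..<2 ^ n + 2 ^ n} = (\<Sum>j<2 ^ n. f (j + 2 ^ n))"
    using sum.shift_bounds_nat_ivl[of f 0 "2 ^ n" "2 ^ n"] by (simp add: atLeast0LessThan)
  finally show ?thesis
    by (simp add: atLeast0LessThan)
qed

text \<open>This is the distributive law: the binary digits of \<open>j\<close> select the factors
  on the right that contribute \<open>e b\<close> instead of 1. It evaluates the Walsh sums below in
  closed form.\<close>

lemma sum_prod_bits:
  fixes e :: "nat \<Rightarrow> 'a::comm_semiring_1"
  shows "(\<Sum>j<2 ^ n. \<Prod>b<n. if bit (j::nat) b then e b else 1) = (\<Prod>b<n. 1 + e b)"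
proof (induction n)
  case (Suc n)
  have low: "(\<Prod>b<Suc n. if bit j b then e b else 1) = (\<Prod>b<n. if bit j b then e b else 1)"
    and high: "(\<Prod>b<Suc n. if bit (j + 2 ^ n) b then e b else 1)
      = (\<Prod>b<n. if bit j b then e b else 1) * e n" if "j < 2 ^ n" for j :: nat
    using bit_add_pow2[OF that] by simp_all
  show ?case
    unfolding sum_lessThan_pow2_Suc
    by (simp add: low high Suc.IH distrib_left del: prod.lessThan_Suc flip: sum_distrib_right)
       (simp add: distrib_left)
qed simp

text \<open>Both signs are merged into one product over the bits of \<open>j\<close>, so that two
  rows multiply factor by factor and \<open>sum_prod_bits\<close> applies once bit \<open>n\<close>
  of \<open>j\<close> is fixed.\<close>

definition twisted_sylvester :: "nat \<Rightarrow> nat set \<Rightarrow> real mat" where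
  "twisted_sylvester n A = mat (2 ^ Suc n) (2 ^ Suc n) (\<lambda>(i, j). \<Prod>b<Suc n.
     if bit j b then (if bit i b then -1 else 1) * (if b \<in> A \<and> bit j n then -1 else 1) else 1)"

lemma twisted_sylvester_carrier [simp]:
  "twisted_sylvester n A \<in> carrier_mat (2 ^ Suc n) (2 ^ Suc n)"
  "dim_row (twisted_sylvester n A) = 2 ^ Suc n"
  "dim_col (twisted_sylvester n A) = 2 ^ Suc n"
  by (simp_all add: twisted_sylvester_def)

text \<open>The sum over columns is split by their top bit. If it is clear, both twists are trivial;
  if it is set, they flip \<open>e b\<close> exactly on the symmetric difference of \<open>A\<close>
  and \<open>B\<close>, and the top bit itself contributes \<open>e n\<close>.\<close>

lemma twisted_sylvester_mult_transpose:
  fixes e :: "nat \<Rightarrow> real"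
  assumes "i < 2 ^ Suc n" "k < 2 ^ Suc n" "n \<notin> A" "n \<notin> B"
  defines "e \<equiv> \<lambda>b. if bit i b = bit k b then 1 else -1"
  shows "(twisted_sylvester n A * (twisted_sylvester n B)\<^sup>T) $$ (i, k)
    = (\<Prod>b<n. 1 + e b) + e n * (\<Prod>b<n. 1 + (if b \<in> A \<longleftrightarrow> b \<in> B then e b else - e b))"
proof -
  define d where "d b = (if b \<in> A \<longleftrightarrow> b \<in> B then e b else - e b)" for b
  let ?f = "\<lambda>j::nat. \<Prod>b<Suc n. if bit j b then (if bit j n then d b else e b) else 1"
  have dn: "d n = e n"
    using assms by (simp add: d_def)
  have "(twisted_sylvester n A * (twisted_sylvester n B)\<^sup>T) $$ (i, k)
    = (\<Sum>j<2 ^ Suc n. twisted_sylvester n A $$ (i, j) * twisted_sylvester n B $$ (k, j))"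
    using assms(1,2) by (simp add: scalar_prod_def atLeast0LessThan)
  also have "\<dots> = (\<Sum>j<2 ^ Suc n. ?f j)"
    using assms(1,2)
    by (intro sum.cong refl)
       (auto simp add: twisted_sylvester_def d_def e_def simp del: prod.lessThan_Suc
          simp flip: prod.distrib intro!: prod.cong)
  also have "\<dots> = (\<Sum>j<2 ^ n. \<Prod>b<n. if bit (j::nat) b then e b else 1)
      + (\<Sum>j<2 ^ n. (\<Prod>b<n. if bit (j::nat) b then d b else 1) * e n)"
    unfolding sum_lessThan_pow2_Suc
    by (intro arg_cong2[where f = "(+)"] sum.cong refl)
       (simp_all add: bit_add_pow2 dn cong: if_cong)
  also have "\<dots> = (\<Prod>b<n. 1 + e b) + e n * (\<Prod>b<n. 1 + d b)"
    by (simp add: sum_prod_bits flip: sum_distrib_right)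
  finally show ?thesis
    by (simp add: d_def)
qed

text \<open>For equal twists the two products agree, so an entry is the product of all
  \<open>1 + e b\<close> up to \<open>b = n\<close>, which vanishes as soon as \<open>i\<close> and
  \<open>k\<close> differ in a bit.\<close>

lemma weighing_twisted_sylvester:
  assumes "n \<notin> A"
  shows "weighing_matrix (2 ^ Suc n) (2 ^ Suc n) (twisted_sylvester n A)"
proof -
  let ?W = "twisted_sylvester n A"
  have "(?W * ?W\<^sup>T) $$ (i, k) = (if i = k then 2 ^ Suc n else 0)"
    if ik: "i < 2 ^ Suc n" "k < 2 ^ Suc n" for i k
  proof -
    let ?e = "\<lambda>b. if bit i b = bit k b then 1 else - 1 :: real"
    have eq: "(?W * ?W\<^sup>T) $$ (i, k) = (\<Prod>b<Suc n. 1 + ?e b)"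
      using twisted_sylvester_mult_transpose[OF ik assms assms] by (simp add: distrib_left)
    show ?thesis
    proof (cases "i = k")
      case True
      then show ?thesis unfolding eq by simp
    next
      case False
      \<comment> \<open>The bounds on \<open>i\<close> and \<open>k\<close> ensure that a differing
        bit occurs among the factors of the product.\<close>
      then have "take_bit (Suc n) i \<noteq> take_bit (Suc n) k"
        using ik by (simp add: take_bit_nat_eq_self)
      then obtain b where "b < Suc n" "bit i b \<noteq> bit k b"
        by (auto simp: bit_eq_iff bit_take_bit_iff)
      then have "(\<Prod>b<Suc n. 1 + ?e b) = 0"
        by (intro prod_zero) auto
      with False show ?thesis unfolding eq by simp
    qed
  qed
  then have "?W * ?W\<^sup>T = real (2 ^ Suc n) \<cdot>\<^sub>m 1\<^sub>m (2 ^ Suc n)"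
    by (intro eq_matI) (simp_all del: index_mult_mat(1))
  moreover have "?W $$ (i, j) \<in> {1, -1, 0}" if "i < 2 ^ Suc n" "j < 2 ^ Suc n" for i j
  proof -
    \<comment> \<open>Infinite \<open>S\<close> is harmless, since the product is then 1 by
      convention.\<close>
    have pm: "prod f S \<in> {1, -1}" if "\<And>b. f b \<in> {1, -1}" for f :: "nat \<Rightarrow> real" and S
      using that by (induction S rule: infinite_finite_induct) (auto, blast+)
    have "?W $$ (i, j) \<in> {1, -1}"
      using that unfolding twisted_sylvester_def
      by (simp del: prod.lessThan_Suc insert_iff) (rule pm, auto)
    then show ?thesis by auto
  qed
  ultimately show ?thesis
    unfolding weighing_matrix_def using twisted_sylvester_carrier(1) by blast
qed

text \<open>Each of the two products is 0 or \<open>2 ^ n\<close>. At a bit \<open>c\<close> where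
  \<open>A\<close> and \<open>B\<close> differ, their factors are \<open>1 + e c\<close> and
  \<open>1 - e c\<close>, one of which is 0, so at most one product survives.\<close>

lemma twisted_sylvester_cross_entries:
  assumes "i < 2 ^ Suc n" "k < 2 ^ Suc n" "A \<subseteq> {..<n}" "B \<subseteq> {..<n}" "A \<noteq> B"
  shows "(twisted_sylvester n A * (twisted_sylvester n B)\<^sup>T) $$ (i, k) \<in> {2 ^ n, - (2 ^ n), 0}"
proof -
  define e :: "nat \<Rightarrow> real" where "e b = (if bit i b = bit k b then 1 else -1)" for b
  define d where "d b = (if b \<in> A \<longleftrightarrow> b \<in> B then e b else - e b)" for b
  have e: "e b \<in> {1, -1}" and d: "d b \<in> {1, -1}" for b
    by (auto simp: e_def d_def)
  have full_or_zero: "(\<Prod>b<n. 1 + f b) = 2 ^ n \<or> (\<Prod>b<n. 1 + f b) = 0"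
    if "\<And>b. f b \<in> {1, -1}" for f :: "nat \<Rightarrow> real"
  proof (cases "\<exists>b<n. f b = -1")
    case True
    then have "\<exists>b\<in>{..<n}. 1 + f b = 0" by force
    then show ?thesis by (simp add: prod_zero)
  next
    case False
    then have "\<forall>b<n. f b = 1" using that by auto
    then show ?thesis by simp
  qed
  obtain c where c: "c < n" "(c \<in> A) \<noteq> (c \<in> B)"
    using assms(3-5) by blast
  then have "d c = - e c"
    by (simp add: d_def)
  then have "1 + e c = 0 \<or> 1 + d c = 0"
    using e[of c] by auto
  then have "(\<Prod>b<n. 1 + e b) = 0 \<or> (\<Prod>b<n. 1 + d b) = 0"
    using \<open>c < n\<close> by (auto simp: prod_zero_iff)
  moreover have "(twisted_sylvester n A * (twisted_sylvester n B)\<^sup>T) $$ (i, k)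
      = (\<Prod>b<n. 1 + e b) + e n * (\<Prod>b<n. 1 + d b)"
    unfolding d_def e_def using assms by (intro twisted_sylvester_mult_transpose) auto
  ultimately show ?thesis
    using full_or_zero[of e, OF e] full_or_zero[of d, OF d] e[of n]
    by (auto simp del: prod_zero_iff)
qed

text \<open>If distinct sets gave the same matrix, its diagonal entry \<open>2 ^ Suc n\<close> would
  have to be one of the cross entries, which are too small. Injectivity is what allows the matrices
  to be counted.\<close>

lemma inj_on_twisted_sylvester: "inj_on (twisted_sylvester n) (Pow {..<n})"
proof (rule inj_onI, rule ccontr)
  fix A B
  assume AB: "A \<in> Pow {..<n}" "B \<in> Pow {..<n}" "A \<noteq> B"
    and eq: "twisted_sylvester n A = twisted_sylvester n B"
  have "(twisted_sylvester n A * (twisted_sylvester n B)\<^sup>T) $$ (0, 0) = 2 ^ Suc n"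
  proof -
    have "n \<notin> B"
      using AB by auto
    then show ?thesis
      using weighing_twisted_sylvester[of n B]
      by (simp add: eq weighing_matrix_def del: index_mult_mat(1))
  qed
  then show False
    using twisted_sylvester_cross_entries[of 0 n 0 A B] AB
    by (auto simp del: index_mult_mat(1))
qed

theorem mutually_quasi_unbiased_twisted_sylvester:
  "mutually_quasi_unbiased (2 ^ Suc n) (2 ^ Suc n) 4 ((2 ^ n)\<^sup>2)
    (twisted_sylvester n ` Pow {..<n})"
proof -
  have "quasi_unbiased (2 ^ Suc n) (2 ^ Suc n) 4 ((2 ^ n)\<^sup>2)
      (twisted_sylvester n A) (twisted_sylvester n B)"
    if "A \<subseteq> {..<n}" "B \<subseteq> {..<n}" "A \<noteq> B" for A B
  proof (rule quasi_unbiasedI)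
    show "weighing_matrix (2 ^ Suc n) (2 ^ Suc n) (twisted_sylvester n A)"
      "weighing_matrix (2 ^ Suc n) (2 ^ Suc n) (twisted_sylvester n B)"
      using that(1,2) by (blast intro: weighing_twisted_sylvester)+
    \<comment> \<open>With \<open>k = 2 ^ Suc n\<close> and \<open>c = 2 ^ n\<close>, the ratio
      \<open>k / c\<close> is 2, whence the weight 4.\<close>
    show "4 * (2 ^ n)\<^sup>2 = (2 ^ Suc n :: nat)\<^sup>2"
      by (simp add: power_mult_distrib)
  qed (use twisted_sylvester_cross_entries[OF _ _ that] in \<open>simp_all del: index_mult_mat(1)\<close>)
  moreover have "weighing_matrix (2 ^ Suc n) (2 ^ Suc n) (twisted_sylvester n A)"
    if "A \<subseteq> {..<n}" for A
    using that by (blast intro: weighing_twisted_sylvester)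
  ultimately show ?thesis
    unfolding mutually_quasi_unbiased_def by auto
qed

theorem corollary7:
  "\<exists>S :: real mat set. mutually_quasi_unbiased 32 32 4 256 S \<and> card S \<ge> 4"
proof (intro exI conjI)
  \<comment> \<open>Here 32 is \<open>2 ^ Suc 4\<close> and 256 is the square of
    \<open>2 ^ 4\<close>.\<close>
  show "mutually_quasi_unbiased 32 32 4 256 (twisted_sylvester 4 ` Pow {..<4})"
    using mutually_quasi_unbiased_twisted_sylvester[of 4] by simp
  show "card (twisted_sylvester 4 ` Pow {..<4}) \<ge> 4"
    by (simp add: card_image[OF inj_on_twisted_sylvester] card_Pow)
qed

end
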